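(* Let $k\ge 1$ and $t\ge 3$ be fixed integers, and let $n\ge k$, with asymptotic notation referring to $n\to\infty$. (a) If $t=3$ and $k<4$, then $m_3(n,k)=\Omega(n^{\lfloor k/2\rfloor})$; and if $t\ge 4$ and $k<2(t-1)$, then $m_t(n,k)\ge n^{\lfloor \frac{(t-2)k}{t-1}\rfloor-o(1)}$. (b) If $t=3$ and $k\ge 4$, then $m_3(n,k)=\Omega(n^{k/2})$; and if $t\ge 4$ and $k\ge 2(t-1)$, then $m_t(n,k)\ge n^{\frac{(t-2)k}{t-1}-o(1)}$.
   Context: A maximal independent set (MIS) of a graph is an independent set that is maximal with respect to inclusion; a $k$-MIS is an MIS of size $k$. A graph is $K_t$-free if it contains no clique on $t$ vertices. $m_t(n,k)$ denotes the maximum number of $k$-MIS's in a $K_t$-free graph on $n$ vertices. *)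

theory Defs
  imports "HOL-Analysis.Analysis" "HOL-Library.Ramsey" "HOL-Library.Landau_Symbols"
begin

text \<open>Finite simple graphs are given by a vertex set and a set of two-element subsets of it.
  \<^const>\<open>clique\<close> and \<^const>\<open>indep\<close> are those of the Ramsey theory.\<close>

definition simple_graph :: "'a set \<Rightarrow> 'a set set \<Rightarrow> bool" where
  "simple_graph V E \<longleftrightarrow> finite V \<and> (\<forall>e\<in>E. e \<subseteq> V \<and> card e = 2)"

definition clique_free :: "nat \<Rightarrow> 'a set \<Rightarrow> 'a set set \<Rightarrow> bool" where
  "clique_free t V E \<longleftrightarrow> \<not> (\<exists>S. S \<subseteq> V \<and> card S = t \<and> clique S E)"

definition is_MIS :: "'a set \<Rightarrow> 'a set set \<Rightarrow> 'a set \<Rightarrow> bool" where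
  "is_MIS V E I \<longleftrightarrow> I \<subseteq> V \<and> indep I E \<and>
     (\<forall>J. I \<subseteq> J \<and> J \<subseteq> V \<and> indep J E \<longrightarrow> J = I)"

definition kMISs :: "nat \<Rightarrow> 'a set \<Rightarrow> 'a set set \<Rightarrow> 'a set set" where
  "kMISs k V E = {I. is_MIS V E I \<and> card I = k}"

text \<open>The vertices are taken to be natural numbers; by \<open>card_kMISs_le_m\<close> below this loses no
  generality. For \<open>t \<ge> 2\<close> the maximum is over a finite nonempty set
  (\<open>kMIS_counts_finite\<close>, \<open>kMIS_counts_nonempty\<close>).\<close>

definition kMIS_counts :: "nat \<Rightarrow> nat \<Rightarrow> nat \<Rightarrow> nat set" where
  "kMIS_counts t n k = {card (kMISs k V E) | (V :: nat set) E.
     simple_graph V E \<and> card V = n \<and> clique_free t V E}"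

definition m :: "nat \<Rightarrow> nat \<Rightarrow> nat \<Rightarrow> nat" where
  "m t n k = Max (kMIS_counts t n k)"

lemma card_kMISs_le:
  assumes "simple_graph V E"
  shows "card (kMISs k V E) \<le> 2 ^ card V"
proof -
  have "finite V" using assms by (simp add: simple_graph_def)
  moreover have "kMISs k V E \<subseteq> Pow V" by (auto simp: kMISs_def is_MIS_def)
  ultimately show ?thesis by (metis card_Pow card_mono finite_Pow_iff)
qed

lemma kMIS_counts_finite: "finite (kMIS_counts t n k)"
proof (rule finite_subset)
  show "kMIS_counts t n k \<subseteq> {..2 ^ n}"
    using card_kMISs_le by (fastforce simp: kMIS_counts_def)
qed simp

lemma kMIS_counts_nonempty:
  assumes "t \<ge> 2"
  shows "kMIS_counts t n k \<noteq> {}"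
proof -
  have "simple_graph {..<n} {}" by (simp add: simple_graph_def)
  moreover have "clique_free t {..<n} {}"
    unfolding clique_free_def
  proof
    assume "\<exists>S\<subseteq>{..<n}. card S = t \<and> clique S {}"
    then obtain S :: "nat set" where S: "card S = t" "clique S {}" by blast
    then have "\<not> card S \<le> 1" "finite S" using assms by (auto intro: card_ge_0_finite)
    then obtain x y where "x \<in> S" "y \<in> S" "x \<noteq> y"
      by (metis card_le_Suc0_iff_eq One_nat_def)
    then show False using S by (auto simp: clique_def)
  qed
  ultimately have "card (kMISs k {..<n} {}) \<in> kMIS_counts t n k"
    unfolding kMIS_counts_def by force
  then show ?thesis by blast
qed

lemma relabel_edge_iff:
  assumes "inj_on f V" "\<forall>e\<in>E. e \<subseteq> V" "v \<in> V" "w \<in> V"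
  shows "{f v, f w} \<in> (`) f ` E \<longleftrightarrow> {v, w} \<in> E"
proof
  assume "{f v, f w} \<in> (`) f ` E"
  then obtain e where e: "e \<in> E" "f ` {v, w} = f ` e" by auto
  moreover have "{v, w} \<subseteq> V" "e \<subseteq> V" using assms e by auto
  ultimately have "{v, w} = e" using inj_on_image_eq_iff[OF assms(1)] by metis
  then show "{v, w} \<in> E" using e by simp
qed (auto intro: image_eqI[where x = "{v, w}"])

lemma relabel_clique_iff:
  assumes "inj_on f V" "\<forall>e\<in>E. e \<subseteq> V" "S \<subseteq> V"
  shows "clique (f ` S) ((`) f ` E) \<longleftrightarrow> clique S E"
proof -
  have "f v = f w \<longleftrightarrow> v = w" "{f v, f w} \<in> (`) f ` E \<longleftrightarrow> {v, w} \<in> E"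
    if "v \<in> S" "w \<in> S" for v w
    using relabel_edge_iff[OF assms(1,2)] inj_on_eq_iff[OF assms(1)] assms(3) that by blast+
  then show ?thesis by (simp add: clique_def)
qed

lemma relabel_indep_iff:
  assumes "inj_on f V" "\<forall>e\<in>E. e \<subseteq> V" "S \<subseteq> V"
  shows "indep (f ` S) ((`) f ` E) \<longleftrightarrow> indep S E"
proof -
  have "f v = f w \<longleftrightarrow> v = w" "{f v, f w} \<in> (`) f ` E \<longleftrightarrow> {v, w} \<in> E"
    if "v \<in> S" "w \<in> S" for v w
    using relabel_edge_iff[OF assms(1,2)] inj_on_eq_iff[OF assms(1)] assms(3) that by blast+
  then show ?thesis by (simp add: indep_def)
qed

lemma card_kMISs_le_m:
  fixes V :: "'a set"
  assumes G: "simple_graph V E" and n: "card V = n" and t: "clique_free t V E"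
  shows "card (kMISs k V E) \<le> m t n k"
proof -
  have fin: "finite V" and E: "\<forall>e\<in>E. e \<subseteq> V" using G by (auto simp: simple_graph_def)
  obtain f :: "'a \<Rightarrow> nat" where f: "inj_on f V"
    using finite_imp_inj_to_nat_seg[OF fin] by metis
  let ?V = "f ` V" and ?E = "(`) f ` E"
  have card_f: "card (f ` S) = card S" if "S \<subseteq> V" for S
    using card_image inj_on_subset[OF f that] by blast
  have G': "simple_graph ?V ?E"
    using G card_f by (fastforce simp: simple_graph_def)
  have t': "clique_free t ?V ?E"
    using t card_f relabel_clique_iff[OF f E]
    unfolding clique_free_def by (metis subset_imageE)
  have mis: "is_MIS ?V ?E (f ` I)" if I: "is_MIS V E I" for I
    unfolding is_MIS_def
  proof (intro conjI allI impI)
    have IV: "I \<subseteq> V" using I by (simp add: is_MIS_def)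
    then show "f ` I \<subseteq> ?V" by blast
    show "indep (f ` I) ?E"
      using I relabel_indep_iff[OF f E IV] by (simp add: is_MIS_def)
    fix J assume J: "f ` I \<subseteq> J \<and> J \<subseteq> ?V \<and> indep J ?E"
    then obtain K where K: "K \<subseteq> V" "J = f ` K" by (metis subset_imageE)
    have "I \<subseteq> K" using J K IV inj_on_image_subset_iff[OF f] by metis
    moreover have "indep K E" using J K relabel_indep_iff[OF f E] by simp
    ultimately have "K = I" using I K unfolding is_MIS_def by blast
    then show "J = f ` I" using K by simp
  qed
  have fin': "finite (kMISs k ?V ?E)"
    by (rule finite_subset[of _ "Pow ?V"]) (use fin in \<open>auto simp: kMISs_def is_MIS_def\<close>)
  have sub: "(`) f ` kMISs k V E \<subseteq> kMISs k ?V ?E"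
  proof (rule image_subsetI)
    fix I assume "I \<in> kMISs k V E"
    then have "is_MIS V E I" "card I = k" "I \<subseteq> V" by (auto simp: kMISs_def is_MIS_def)
    then show "f ` I \<in> kMISs k ?V ?E" using mis card_f by (simp add: kMISs_def)
  qed
  have "kMISs k V E \<subseteq> Pow V" by (auto simp: kMISs_def is_MIS_def)
  then have "inj_on ((`) f) (kMISs k V E)"
    using inj_on_subset[OF inj_on_image_Pow[OF f]] by blast
  then have le: "card (kMISs k V E) \<le> card (kMISs k ?V ?E)"
    using card_inj_on_le sub fin' by metis
  have "card ?V = n" using card_f[of V] n by simp
  then have "card (kMISs k ?V ?E) \<in> kMIS_counts t n k"
    unfolding kMIS_counts_def using G' t' by blast
  then have "card (kMISs k ?V ?E) \<le> m t n k"
    unfolding m_def by (rule Max_ge[OF kMIS_counts_finite])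
  with le show ?thesis by (rule le_trans)
qed

end

theory Submission
  imports Defs "HOL-Number_Theory.Cong" "HOL-Real_Asymp.Real_Asymp"
begin

text \<open>
  Take \<open>k\<close> parts and a family of windows, that is, sets of parts. A vertex of part \<open>i\<close> carries one
  label from \<open>Q\<close> for each window through \<open>i\<close>, and two vertices of different parts are adjacent iff
  their labels violate a relation attached to some common window. If in each window two solutions
  of the relation that agree in all places but one are equal, then choosing a solution in every
  window gives a \<open>k\<close>-MIS, and a clique meets only parts that pairwise share a window.

  For the relation on a window of \<open>w\<close> parts, consider integer vectors \<open>y\<^sub>1, \<dots>, y\<^sub>w\<close> in a box of side
  of order \<open>M\<close> in dimension \<open>d\<close> with \<open>y\<^sub>1 + \<dots> + y\<^sub>w = 0\<close>. By pigeonhole, about \<open>M\<^bsup>d(w-1)\<^esup>\<close> of these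
  tuples, up to a factor polynomial in \<open>M\<close> whose degree does not depend on \<open>d\<close>, have the same Gram
  matrix. Prescribing this Gram matrix is a pairwise condition, and it forces the norm of the sum to
  vanish, so any \<open>w - 1\<close> of the vectors determine the last one.

  For \<open>k \<ge> 2(t-1)\<close> the windows are the \<open>k\<close> cyclic intervals of length \<open>t - 1\<close>; for smaller \<open>k\<close> the parts
  are split into at most two disjoint windows. For \<open>t = 3\<close> the windows have at most two elements,
  and equality of labels replaces the Gram condition without any loss.
\<close>

section \<open>Graphs from windows\<close>

text \<open>The case \<open>i = j\<close> is included, so \<open>R i i\<close> also restricts single
  labels. Extensional functions make solutions comparable by equality.\<close>

definition sols :: "'i set \<Rightarrow> 'b set \<Rightarrow> ('i \<Rightarrow> 'i \<Rightarrow> 'b \<Rightarrow> 'b \<Rightarrow> bool) \<Rightarrow> ('i \<Rightarrow> 'b) set" where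
  "sols W Q R = {y \<in> W \<rightarrow>\<^sub>E Q. \<forall>i\<in>W. \<forall>j\<in>W. R i j (y i) (y j)}"

text \<open>The solutions form a code of minimum distance at least two, which is what makes the
  independent sets maximal. The symmetry of \<open>R\<close> makes adjacency symmetric.\<close>

definition rigid :: "'i set \<Rightarrow> 'b set \<Rightarrow> ('i \<Rightarrow> 'i \<Rightarrow> 'b \<Rightarrow> 'b \<Rightarrow> bool) \<Rightarrow> bool" where
  "rigid W Q R \<longleftrightarrow> (\<forall>i j x y. R i j x y \<longrightarrow> R j i y x) \<and>
     (\<forall>y\<in>sols W Q R. \<forall>z\<in>sols W Q R. \<forall>i\<in>W. (\<forall>j\<in>W - {i}. y j = z j) \<longrightarrow> y = z)"

lemma rigid_eqI:
  assumes "rigid W Q R" "y \<in> sols W Q R" "z \<in> sols W Q R" "i \<in> W"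
    and "\<And>j. j \<in> W \<Longrightarrow> j \<noteq> i \<Longrightarrow> y j = z j"
  shows "y = z"
  using assms unfolding rigid_def by blast

text \<open>\<open>s\<close> bounds the cliques among the parts, \<open>D\<close> the number of windows through a part.\<close>

definition window_family :: "nat \<Rightarrow> nat \<Rightarrow> nat \<Rightarrow> nat \<Rightarrow> (nat \<Rightarrow> nat set) \<Rightarrow> bool" where
  "window_family s k D L W \<longleftrightarrow>
     (\<forall>l<L. W l \<subseteq> {..<k}) \<and>
     (\<forall>i<k. card {l. l < L \<and> i \<in> W l} \<le> D) \<and>
     (\<forall>S\<subseteq>{..<k}. (\<forall>i\<in>S. \<forall>j\<in>S. i \<noteq> j \<longrightarrow> (\<exists>l<L. i \<in> W l \<and> j \<in> W l)) \<longrightarrow> card S \<le> s)"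

lemma window_family_clique:
  assumes F: "window_family s k D L W" and S: "S \<subseteq> {..<k}"
    and "\<And>i j. i \<in> S \<Longrightarrow> j \<in> S \<Longrightarrow> i \<noteq> j \<Longrightarrow> \<exists>l<L. i \<in> W l \<and> j \<in> W l"
  shows "card S \<le> s"
proof -
  have "(\<forall>i\<in>S. \<forall>j\<in>S. i \<noteq> j \<longrightarrow> (\<exists>l<L. i \<in> W l \<and> j \<in> W l)) \<longrightarrow> card S \<le> s"
    using F S unfolding window_family_def by simp
  with assms(3) show ?thesis by simp
qed

lemma window_family_subset:
  assumes "window_family s k D L W" "l < L"
  shows "W l \<subseteq> {..<k}"
  using assms by (simp add: window_family_def)

text \<open>Any two parts of a window share that window, so the window is itself a clique of
  parts.\<close>

lemma window_family_card_le:
  assumes "window_family s k D L W" "l < L"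
  shows "card (W l) \<le> s"
  by (rule window_family_clique[OF assms(1) window_family_subset[OF assms]]) (use assms(2) in blast)

locale window_graph =
  fixes s k D L n :: nat and W :: "nat \<Rightarrow> nat set" and Q :: "'b set"
    and R :: "nat \<Rightarrow> nat \<Rightarrow> nat \<Rightarrow> 'b \<Rightarrow> 'b \<Rightarrow> bool"
  assumes family: "window_family s k D L W"
    and s: "s \<ge> 2"
    and k: "k \<ge> 1"
    and finQ: "finite Q" and Q: "Q \<noteq> {}"
    and rigid: "\<And>l. l < L \<Longrightarrow> rigid (W l) Q (R l)"
    and n: "k * card Q ^ D \<le> n"
begin

section \<open>The graph of a window family: vertices, edges and cliques\<close>

definition "idx i = {l. l < L \<and> i \<in> W l}"

text \<open>The diagonal condition is needed for maximality: a label put into a solution at place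
  \<open>i\<close> must not violate \<open>R l i i\<close>.\<close>

definition "pvert i = {f \<in> idx i \<rightarrow>\<^sub>E Q. \<forall>l\<in>idx i. R l i i (f l) (f l)}"

text \<open>The vertices \<open>Inr p\<close> pad the graph to exactly \<open>n\<close> vertices. They are joined to all of part
  \<open>0\<close>, so none of them can be added to an independent set meeting that part.\<close>

definition verts :: "((nat \<times> (nat \<Rightarrow> 'b)) + nat) set" where
  "verts = Inl ` (SIGMA i:{..<k}. pvert i) \<union> Inr ` {..<n - card (SIGMA i:{..<k}. pvert i)}"

fun adj :: "(nat \<times> (nat \<Rightarrow> 'b)) + nat \<Rightarrow> (nat \<times> (nat \<Rightarrow> 'b)) + nat \<Rightarrow> bool" where
  "adj (Inl (i, f)) (Inl (j, g)) \<longleftrightarrow> i \<noteq> j \<and> (\<exists>l\<in>idx i \<inter> idx j. \<not> R l i j (f l) (g l))"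
| "adj (Inl (i, f)) (Inr p) \<longleftrightarrow> i = 0"
| "adj (Inr p) (Inl (i, f)) \<longleftrightarrow> i = 0"
| "adj (Inr p) (Inr q) \<longleftrightarrow> False"

definition "edges = {{u, v} | u v. u \<in> verts \<and> v \<in> verts \<and> adj u v}"

lemma R_sym: "l < L \<Longrightarrow> R l i j x y \<Longrightarrow> R l j i y x"
  using rigid unfolding rigid_def by blast

lemma adj_sym: "adj u v \<Longrightarrow> adj v u"
  by (induction u v rule: adj.induct) (auto simp: idx_def dest: R_sym)

lemma adj_irrefl: "\<not> adj u u"
  by (cases u) auto

lemma edges_iff: "{u, v} \<in> edges \<longleftrightarrow> u \<in> verts \<and> v \<in> verts \<and> adj u v"
  unfolding edges_def using adj_sym by (auto simp: doubleton_eq_iff)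

lemma finite_idx: "finite (idx i)"
  by (simp add: idx_def)

lemma card_pvert_le:
  assumes "i < k"
  shows "finite (pvert i)" "card (pvert i) \<le> card Q ^ D"
proof -
  have fin: "finite (idx i \<rightarrow>\<^sub>E Q)"
    using finQ finite_idx by (simp add: finite_PiE)
  then show "finite (pvert i)" by (simp add: pvert_def)
  have "card (pvert i) \<le> card (idx i \<rightarrow>\<^sub>E Q)"
    by (rule card_mono[OF fin]) (auto simp: pvert_def)
  also have "\<dots> = card Q ^ card (idx i)"
    using finite_idx by (simp add: card_PiE)
  also have "\<dots> \<le> card Q ^ D"
    using family assms finQ Q unfolding window_family_def idx_def
    by (intro power_increasing) (auto simp: Suc_le_eq card_gt_0_iff)
  finally show "card (pvert i) \<le> card Q ^ D" .
qed

lemma card_verts: "finite verts" "card verts = n"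
proof -
  let ?S = "SIGMA i:{..<k}. pvert i"
  have fin: "finite ?S" using card_pvert_le by auto
  then show "finite verts" by (simp add: verts_def)
  have "card ?S = (\<Sum>i<k. card (pvert i))"
    using card_pvert_le by (subst card_SigmaI) auto
  also have "\<dots> \<le> (\<Sum>i<k. card Q ^ D)"
    using card_pvert_le by (intro sum_mono) auto
  also have "\<dots> \<le> n" using n by simp
  finally have "card ?S \<le> n" .
  moreover have "card verts = card ?S + (n - card ?S)"
    unfolding verts_def using fin by (subst card_Un_disjoint) (auto simp: card_image)
  ultimately show "card verts = n" by simp
qed

lemma simple_graph_window: "simple_graph verts edges"
  unfolding simple_graph_def
proof (intro conjI ballI card_verts)
  fix e assume "e \<in> edges"
  then obtain u v where e: "e = {u, v}" "u \<in> verts" "v \<in> verts" "adj u v"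
    unfolding edges_def by blast
  then show "e \<subseteq> verts" by simp
  have "u \<noteq> v" using e adj_irrefl by blast
  then show "card e = 2" using e by simp
qed

text \<open>A clique without padding vertices has at most one vertex in each part, and its parts
  pairwise share windows, so the family bounds it by \<open>s\<close>. The neighbours of a padding
  vertex all lie in part \<open>0\<close> and are pairwise non-adjacent, so a clique containing one
  has at most \<open>2 \<le> s\<close> vertices.\<close>

lemma clique_free_window: "clique_free (Suc s) verts edges"
  unfolding clique_free_def
proof
  assume "\<exists>S\<subseteq>verts. card S = Suc s \<and> clique S edges"
  then obtain S where S: "S \<subseteq> verts" "card S = Suc s" "clique S edges" by blast
  have fin: "finite S" using S(2) card_ge_0_finite by force
  have adjS: "adj u v" if "u \<in> S" "v \<in> S" "u \<noteq> v" for u v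
    using S(3) that edges_iff unfolding clique_def by blast
  show False
  proof (cases "\<exists>p. Inr p \<in> S")
    case True
    then obtain p where p: "Inr p \<in> S" by blast
    have "u = v" if "u \<in> S - {Inr p}" "v \<in> S - {Inr p}" for u v
    proof (rule ccontr)
      assume "u \<noteq> v"
      then have "adj u v" "adj (Inr p) u" "adj (Inr p) v" using adjS that p by auto
      then show False by (cases u; cases v) auto
    qed
    then have "card (S - {Inr p}) \<le> 1"
      using fin by (auto simp: card_le_Suc0_iff_eq)
    then show False using fin p S(2) s by simp
  next
    case False
    let ?h = "\<lambda>u :: (nat \<times> (nat \<Rightarrow> 'b)) + nat. fst (projl u)"
    have *: "?h u \<noteq> ?h v \<and> (\<exists>l<L. ?h u \<in> W l \<and> ?h v \<in> W l)"
      if "u \<in> S" "v \<in> S" "u \<noteq> v" for u v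
    proof -
      have "adj u v" using adjS that by blast
      moreover have "\<exists>x. u = Inl x" "\<exists>x. v = Inl x" using that False by (metis sum.exhaust)+
      ultimately show ?thesis by (auto simp: idx_def)
    qed
    have "inj_on ?h S" by (rule inj_onI) (use * in blast)
    then have "card (?h ` S) = Suc s" using S(2) by (simp add: card_image)
    moreover have "?h ` S \<subseteq> {..<k}"
    proof (rule image_subsetI)
      fix u assume "u \<in> S"
      then have "u \<in> verts" "\<nexists>p. u = Inr p" using S(1) False by blast+
      then show "?h u \<in> {..<k}" by (auto simp: verts_def)
    qed
    moreover have "\<exists>l<L. i \<in> W l \<and> j \<in> W l"
      if ij: "i \<in> ?h ` S" "j \<in> ?h ` S" "i \<noteq> j" for i j
    proof -
      obtain u v where "u \<in> S" "v \<in> S" "i = ?h u" "j = ?h v"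
        using ij(1,2) by (elim imageE)
      then show ?thesis using *[of u v] \<open>i \<noteq> j\<close> by auto
    qed
    ultimately have "Suc s \<le> s"
      using window_family_clique[OF family, of "?h ` S"] by simp
    then show False by simp
  qed
qed

section \<open>Maximal independent sets from solutions in all windows\<close>

definition "vertex y i = (\<lambda>l\<in>idx i. y l i)"

definition mis :: "(nat \<Rightarrow> nat \<Rightarrow> 'b) \<Rightarrow> ((nat \<times> (nat \<Rightarrow> 'b)) + nat) set" where
  "mis y = (\<lambda>i. Inl (i, vertex y i)) ` {..<k}"

text \<open>Independence says that the relations hold between the chosen labels. If a vertex of part
  \<open>i\<close> has no neighbour in the set, its label can replace the one at \<open>i\<close> in
  each window through \<open>i\<close>; the result is again a solution, so rigidity makes it the old
  one and the vertex was already chosen.\<close>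

lemma is_MIS_mis:
  assumes y: "y \<in> (\<Pi>\<^sub>E l\<in>{..<L}. sols (W l) Q (R l))"
  shows "is_MIS verts edges (mis y)"
  unfolding is_MIS_def
proof (intro conjI allI impI)
  have sol: "y l \<in> sols (W l) Q (R l)" if "l \<in> idx i" for l i
    using y that by (auto simp: idx_def)
  have Ry: "R l i j (y l i) (y l j)" if "l \<in> idx i" "l \<in> idx j" for l i j
    using sol[OF that(1)] that by (auto simp: sols_def idx_def)
  have yQ: "y l i \<in> Q" if "l \<in> idx i" for l i
    using sol[OF that(1)] that by (auto simp: sols_def idx_def)
  have "vertex y i \<in> pvert i" for i
    unfolding pvert_def vertex_def using Ry yQ by auto
  then show sub: "mis y \<subseteq> verts" by (auto simp: mis_def verts_def)
  show "indep (mis y) edges"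
    unfolding indep_def mis_def using Ry by (auto simp: edges_iff vertex_def)
  fix J assume J: "mis y \<subseteq> J \<and> J \<subseteq> verts \<and> indep J edges"
  have "w \<in> mis y" if w: "w \<in> J" for w
  proof (rule ccontr)
    assume nw: "w \<notin> mis y"
    have wV: "w \<in> verts" using J w by blast
    have nadj: "\<not> adj w v" if "v \<in> mis y" for v
    proof -
      have v: "v \<in> J" "w \<noteq> v" "v \<in> verts" using that J nw by blast+
      then have "{w, v} \<notin> edges" using J w unfolding indep_def by simp
      then show ?thesis using v wV by (simp add: edges_iff)
    qed
    show False
    proof (cases w)
      case (Inr p)
      have "Inl (0, vertex y 0) \<in> mis y"
        unfolding mis_def by (rule image_eqI[OF refl]) (use k in simp)
      from nadj[OF this] show False using Inr by simp
    next
      case (Inl x)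
      obtain i f where x: "x = (i, f)" by force
      then have i: "i < k" and f: "f \<in> pvert i" using wV Inl by (auto simp: verts_def)
      have "f l = y l i" if l: "l \<in> idx i" for l
      proof -
        have lL: "l < L" "i \<in> W l" using l by (auto simp: idx_def)
        have fl: "f l \<in> Q" "R l i i (f l) (f l)" using f l by (auto simp: pvert_def)
        have Rf: "R l i j (f l) (y l j)" if j: "j \<in> W l" "j \<noteq> i" for j
        proof -
          have "j < k" using window_family_subset[OF family lL(1)] j by blast
          then have "Inl (j, vertex y j) \<in> mis y" by (auto simp: mis_def)
          moreover have "l \<in> idx j" using lL j by (simp add: idx_def)
          ultimately show ?thesis using nadj[of "Inl (j, vertex y j)"] Inl x l j
            by (auto simp: vertex_def)
        qed
        \<comment> \<open>The exchanged tuple is a solution: the pair \<open>(i, i)\<close> is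
          covered by \<open>pvert\<close>, pairs containing \<open>i\<close> once by non-adjacency,
          and all others by \<open>y l\<close>.\<close>
        let ?z = "(y l)(i := f l)"
        have yl: "y l \<in> sols (W l) Q (R l)" by (rule sol[OF l])
        have "?z \<in> W l \<rightarrow>\<^sub>E Q" using yl fl lL by (auto simp: sols_def PiE_iff extensional_def)
        moreover have "R l a b (?z a) (?z b)" if "a \<in> W l" "b \<in> W l" for a b
          using that fl Rf R_sym[OF lL(1) Rf] yl by (cases "a = i"; cases "b = i") (auto simp: sols_def)
        ultimately have "?z \<in> sols (W l) Q (R l)" by (simp add: sols_def)
        then have "y l = ?z" by (rule rigid_eqI[OF rigid[OF lL(1)] yl _ lL(2)]) simp
        from fun_cong[OF this, of i] show ?thesis by simp
      qed
      then have "f = vertex y i"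
        using f by (auto simp: pvert_def vertex_def PiE_iff extensional_def)
      then show False using nw Inl x i by (auto simp: mis_def)
    qed
  qed
  then show "J = mis y" using J by blast
qed

text \<open>The vertex in part \<open>i\<close> records \<open>y l i\<close> for every window
  \<open>l\<close> through \<open>i\<close>, so all solutions can be read off from the set.\<close>

lemma inj_on_mis: "inj_on mis (\<Pi>\<^sub>E l\<in>{..<L}. sols (W l) Q (R l))"
proof (rule inj_onI)
  fix y z
  assume y: "y \<in> (\<Pi>\<^sub>E l\<in>{..<L}. sols (W l) Q (R l))"
    and z: "z \<in> (\<Pi>\<^sub>E l\<in>{..<L}. sols (W l) Q (R l))" and eq: "mis y = mis z"
  have "y l = z l" if l: "l < L" for l
  proof
    fix i
    have yz: "y l \<in> W l \<rightarrow>\<^sub>E Q" "z l \<in> W l \<rightarrow>\<^sub>E Q"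
      using y z l by (auto simp: sols_def PiE_iff)
    show "y l i = z l i"
    proof (cases "i \<in> W l")
      case True
      then have "i < k" using window_family_subset[OF family l] by blast
      then have "Inl (i, vertex y i) \<in> mis y" by (auto simp: mis_def)
      then have "Inl (i, vertex y i) \<in> mis z" by (simp only: eq)
      then have "vertex y i = vertex z i" by (auto simp: mis_def)
      then have "vertex y i l = vertex z i l" by simp
      then show ?thesis using True l by (simp add: vertex_def idx_def)
    next
      case False
      then show ?thesis using yz by (auto simp: PiE_iff extensional_def)
    qed
  qed
  then show "y = z" using y z by (intro PiE_ext[OF y z]) simp
qed

lemma prod_card_sols_le_m: "(\<Prod>l<L. card (sols (W l) Q (R l))) \<le> m (Suc s) n k"
proof -
  let ?Y = "\<Pi>\<^sub>E l\<in>{..<L}. sols (W l) Q (R l)"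
  have "card (mis y) = k" for y
    unfolding mis_def by (subst card_image) (auto simp: inj_on_def)
  then have "mis ` ?Y \<subseteq> kMISs k verts edges"
    using is_MIS_mis by (auto simp: kMISs_def)
  moreover have "finite (kMISs k verts edges)"
    by (rule finite_subset[of _ "Pow verts"])
      (auto simp: kMISs_def is_MIS_def card_verts(1))
  ultimately have "card (mis ` ?Y) \<le> card (kMISs k verts edges)" by (intro card_mono)
  also have "\<dots> \<le> m (Suc s) n k"
    by (rule card_kMISs_le_m[OF simple_graph_window card_verts(2) clique_free_window])
  finally show ?thesis
    using inj_on_mis by (simp add: card_image card_PiE)
qed

end

section \<open>Rigid relations\<close>

lemma finite_sols: "finite W \<Longrightarrow> finite Q \<Longrightarrow> finite (sols W Q R)"
  by (rule finite_subset[of _ "W \<rightarrow>\<^sub>E Q"]) (auto simp: sols_def finite_PiE)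

text \<open>All vectors but one are free, which gives the left side. The second factor on the right
  counts the possible Gram matrices; its exponent is independent of \<open>d\<close>, so for large
  \<open>d\<close> the loss is small compared with the main term.\<close>

lemma rigid_zero_sum:
  fixes W :: "'i set" and d M s :: nat
  defines "Q \<equiv> {..<d} \<rightarrow>\<^sub>E {- int (s * M)..int (s * M)}"
  assumes W: "finite W" "card W \<le> s" and M: "M \<ge> 1"
  shows "\<exists>R. rigid W Q R \<and>
    M ^ (d * (card W - 1)) \<le> card (sols W Q R) * (2 * (d * (s * M)\<^sup>2) + 1) ^ (card W * card W)"
proof (cases "W = {}")
  case True
  \<comment> \<open>An empty window has exactly one solution, and the truncated exponent
    \<open>card W - 1\<close> is \<open>0\<close>, so both sides are \<open>1\<close>.\<close>
  have "rigid W Q (\<lambda>_ _ _ _. True)" using True by (auto simp: rigid_def sols_def)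
  moreover have "sols W Q (\<lambda>_ _ _ _. True) = {\<lambda>_. undefined}"
    using True by (simp add: sols_def)
  ultimately show ?thesis using True by (intro exI[of _ "\<lambda>_ _ _ _. True"]) simp
next
  case False
  then obtain u where u: "u \<in> W" by blast
  have finQ: "finite Q" by (simp add: Q_def finite_PiE)
  define ip where "ip x y = (\<Sum>c<d. x c * y c :: int)" for x y :: "nat \<Rightarrow> int"
  define T where "T = {y \<in> W \<rightarrow>\<^sub>E Q. \<forall>c<d. (\<Sum>i\<in>W. y i c) = 0}"
  define P where "P = (W - {u}) \<rightarrow>\<^sub>E ({..<d} \<rightarrow>\<^sub>E {0..<int M})"
  \<comment> \<open>The vectors off \<open>u\<close> are free, with entries in
    \<open>[0, M)\<close>, and the one at \<open>u\<close> is minus their sum. Restriction to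
    \<open>W - {u}\<close> recovers the choice.\<close>
  define ext where "ext y = y(u := \<lambda>c\<in>{..<d}. - (\<Sum>i\<in>W - {u}. y i c))" for y :: "'i \<Rightarrow> nat \<Rightarrow> int"
  have finT: "finite T"
    by (rule finite_subset[of _ "W \<rightarrow>\<^sub>E Q"]) (auto simp: T_def finite_PiE W finQ)
  have card_P: "card P = M ^ (d * (card W - 1))"
    using W u by (simp add: P_def card_PiE card_Diff_singleton power_mult)
  have "inj_on ext P"
  proof (rule inj_onI)
    fix y z assume y: "y \<in> P" and z: "z \<in> P" and eq: "ext y = ext z"
    have "y i = z i" if "i \<in> W - {u}" for i
      using fun_cong[OF eq, of i] that by (simp add: ext_def)
    then show "y = z" using y z unfolding P_def by (intro PiE_ext) auto
  qed
  moreover have "ext ` P \<subseteq> T"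
  proof (rule image_subsetI)
    fix y assume y: "y \<in> P"
    have y_range: "0 \<le> y i c \<and> y i c < int M" if "i \<in> W - {u}" "c < d" for i c
      using y that by (fastforce simp: P_def PiE_iff)
    \<comment> \<open>The box has side of order \<open>s * M\<close> because minus a sum of fewer
      than \<open>s + 1\<close> entries from \<open>[0, M)\<close> has to fit.\<close>
    have "- (\<Sum>i\<in>W - {u}. y i c) \<in> {- int (s * M)..int (s * M)}" if c: "c < d" for c
    proof -
      have "0 \<le> (\<Sum>i\<in>W - {u}. y i c)" using y_range c by (intro sum_nonneg) auto
      have "(\<Sum>i\<in>W - {u}. y i c) \<le> (\<Sum>i\<in>W - {u}. int M)"
        using y_range c by (intro sum_mono) force
      also have "\<dots> \<le> (\<Sum>i\<in>W. int M)" using W by (intro sum_mono2) auto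
      also have "\<dots> \<le> int (s * M)" using W by (simp add: mult_right_mono)
      finally have "(\<Sum>i\<in>W - {u}. y i c) \<le> int (s * M)" .
      with \<open>0 \<le> (\<Sum>i\<in>W - {u}. y i c)\<close> show ?thesis by simp
    qed
    then have extu: "ext y u \<in> Q" unfolding ext_def Q_def by (simp add: restrict_PiE_iff)
    have M_le: "int M \<le> int (s * M)" using W u by (cases s) auto
    have "y i \<in> Q" if i: "i \<in> W - {u}" for i
    proof -
      have "y i c \<in> {- int (s * M)..int (s * M)}" if "c < d" for c
        unfolding atLeastAtMost_iff using y_range[OF i that] M_le by linarith
      moreover have "y i \<in> extensional {..<d}" using y i by (auto simp: P_def PiE_iff)
      ultimately show ?thesis unfolding Q_def PiE_iff by blast
    qed
    then have "ext y i \<in> Q" if "i \<in> W" for i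
      using extu that by (cases "i = u") (auto simp: ext_def)
    moreover have "ext y \<in> extensional W"
      using y u by (auto simp: ext_def P_def PiE_iff extensional_def)
    moreover have "(\<Sum>i\<in>W. ext y i c) = 0" if "c < d" for c
      using that u W by (simp add: sum.remove[of W u] ext_def)
    ultimately show "ext y \<in> T" by (auto simp: T_def PiE_iff)
  qed
  ultimately have card_T: "M ^ (d * (card W - 1)) \<le> card T"
    using card_inj_on_le[OF _ _ finT] card_P by metis
  then have "card T > 0" using M by (meson less_le_trans zero_less_one zero_less_power less_eq_Suc_le One_nat_def)
  define B where "B = d * (s * M)\<^sup>2"
  define gram where "gram y = (\<lambda>(i, j)\<in>W \<times> W. ip (y i) (y j))" for y :: "'i \<Rightarrow> nat \<Rightarrow> int"
  define G where "G = (W \<times> W) \<rightarrow>\<^sub>E {- int B..int B}"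
  have ip_le: "\<bar>ip x y\<bar> \<le> int B" if "x \<in> Q" "y \<in> Q" for x y
  proof -
    have "\<bar>ip x y\<bar> \<le> (\<Sum>c<d. \<bar>x c * y c\<bar>)" unfolding ip_def by (rule sum_abs)
    also have "\<dots> \<le> (\<Sum>c<d. (int (s * M))\<^sup>2)"
    proof (rule sum_mono)
      fix c assume "c \<in> {..<d}"
      then have "\<bar>x c\<bar> \<le> int (s * M)" "\<bar>y c\<bar> \<le> int (s * M)"
        using that unfolding Q_def PiE_iff by force+
      then show "\<bar>x c * y c\<bar> \<le> (int (s * M))\<^sup>2"
        unfolding abs_mult power2_eq_square by (intro mult_mono) auto
    qed
    also have "\<dots> = int B" by (simp add: B_def)
    finally show ?thesis .
  qed
  have gram_in: "gram \<in> T \<rightarrow> G"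
  proof
    fix y assume "y \<in> T"
    then have "y i \<in> Q" if "i \<in> W" for i using that by (auto simp: T_def PiE_iff)
    then show "gram y \<in> G" using ip_le by (fastforce simp: gram_def G_def abs_le_iff)
  qed
  have finG: "finite G" using W by (simp add: G_def finite_PiE)
  \<comment> \<open>The zero matrix only witnesses that \<open>G\<close> is nonempty, as the
    pigeonhole principle requires.\<close>
  have "(\<lambda>_\<in>W \<times> W. 0) \<in> G" by (auto simp: G_def)
  then obtain C where C: "card T \<le> card (gram -` {C} \<inter> T) * card G"
    using pigeonhole_card[OF gram_in finT finG] by blast
  then have "gram -` {C} \<inter> T \<noteq> {}" using \<open>card T > 0\<close> by auto
  then obtain y0 where y0: "y0 \<in> T" "gram y0 = C" by blast
  define R where "R i j x y \<longleftrightarrow> ip x y = ip (y0 i) (y0 j)" for i j x y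
  \<comment> \<open>The squared norm of the sum is the sum of all Gram entries. A solution has the
    same entries as \<open>y0\<close>, whose sum vanishes, so its own sum vanishes in every
    coordinate.\<close>
  have sq: "(\<Sum>c<d. (\<Sum>i\<in>W. y i c)\<^sup>2) = (\<Sum>i\<in>W. \<Sum>j\<in>W. ip (y i) (y j))" for y
    unfolding ip_def power2_eq_square sum_product
    by (subst sum.swap) (intro sum.cong refl sum.swap)
  have zero: "(\<Sum>i\<in>W. y i c) = 0" if y: "y \<in> sols W Q R" and c: "c < d" for y c
  proof -
    have "(\<Sum>c<d. (\<Sum>i\<in>W. y i c)\<^sup>2) = (\<Sum>c<d. (\<Sum>i\<in>W. y0 i c)\<^sup>2)"
      unfolding sq using y by (intro sum.cong refl) (simp add: sols_def R_def)
    also have "\<dots> = 0" using y0 by (simp add: T_def)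
    finally show ?thesis using c by (simp add: sum_nonneg_eq_0_iff)
  qed
  have "rigid W Q R"
    unfolding rigid_def
  proof (intro conjI allI impI ballI)
    show "R j i y x" if "R i j x y" for i j x y
      using that by (simp add: R_def ip_def mult.commute)
    fix y z i
    assume y: "y \<in> sols W Q R" and z: "z \<in> sols W Q R" and i: "i \<in> W"
      and eq: "\<forall>j\<in>W - {i}. y j = z j"
    have yz: "y \<in> W \<rightarrow>\<^sub>E Q" "z \<in> W \<rightarrow>\<^sub>E Q" using y z by (auto simp: sols_def)
    have "y i c = z i c" if "c \<in> {..<d}" for c
    proof -
      have "(\<Sum>j\<in>W - {i}. y j c) = (\<Sum>j\<in>W - {i}. z j c)" using eq by (intro sum.cong) auto
      then show ?thesis
        using zero[OF y, of c] zero[OF z, of c] that i W by (simp add: sum.remove[of W i])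
    qed
    moreover have "y i \<in> Q" "z i \<in> Q" using yz i by auto
    ultimately have "y i = z i" unfolding Q_def by (metis PiE_ext)
    then show "y = z" using yz eq by (intro PiE_ext[OF yz]) auto
  qed
  moreover have "M ^ (d * (card W - 1)) \<le> card (sols W Q R) * (2 * B + 1) ^ (card W * card W)"
  proof -
    have "R i j (y i) (y j)" if "y \<in> gram -` {C} \<inter> T" "i \<in> W" "j \<in> W" for y i j
    proof -
      have "gram y (i, j) = gram y0 (i, j)" using that y0 by simp
      then show ?thesis using that by (simp add: gram_def R_def)
    qed
    then have "gram -` {C} \<inter> T \<subseteq> sols W Q R" by (auto simp: sols_def T_def)
    then have "card (gram -` {C} \<inter> T) \<le> card (sols W Q R)"
      using finite_sols W finQ by (metis card_mono)
    moreover have "card G = (2 * B + 1) ^ (card W * card W)"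
      using W by (simp add: G_def card_PiE card_cartesian_product) (simp add: nat_add_distrib nat_mult_distrib)
    ultimately show ?thesis using card_T C by (metis (no_types, lifting) le_trans mult_le_mono1)
  qed
  ultimately show ?thesis unfolding B_def by blast
qed

text \<open>On two parts either of two equal labels determines the other, and there are
  \<open>card Q\<close> constant solutions. On a single part, agreement off \<open>i\<close> is
  vacuous, so rigidity allows only one solution; the relation therefore pins the label to
  \<open>q\<close>.\<close>

lemma rigid_diagonal:
  fixes W :: "'i set" and Q :: "'b set"
  assumes W: "finite W" "card W \<le> 2" and Q: "finite Q" "Q \<noteq> {}"
  shows "\<exists>R. rigid W Q R \<and> card Q ^ (card W - 1) \<le> card (sols W Q R)"
proof -
  obtain q where q: "q \<in> Q" using Q by blast
  define R where "R i j x y \<longleftrightarrow> x = y \<and> (card W \<le> 1 \<longrightarrow> x = q \<and> y = q)" for i j :: 'i and x y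
  have R: "R i j (y i) (y j)" if "y \<in> sols W Q R" "i \<in> W" "j \<in> W" for y i j
    using that unfolding sols_def by blast
  have "rigid W Q R"
    unfolding rigid_def
  proof (intro conjI allI impI ballI)
    show "R j i y x" if "R i j x y" for i j x y
      using that by (simp add: R_def)
    fix y z i assume y: "y \<in> sols W Q R" and z: "z \<in> sols W Q R" and i: "i \<in> W"
      and eq: "\<forall>j\<in>W - {i}. y j = z j"
    have "y i = z i"
    proof (cases "card W \<le> 1")
      case True
      then show ?thesis using R[OF y i i] R[OF z i i] unfolding R_def by simp
    next
      case False
      then have "card (W - {i}) \<noteq> 0" using W i by simp
      then have "W - {i} \<noteq> {}" by (metis card.empty)
      then obtain j where j: "j \<in> W - {i}" by blast
      then have "y i = y j" "z i = z j"
        using R[OF y i, of j] R[OF z i, of j] by (simp_all only: R_def Diff_iff)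
      then show ?thesis using eq j by simp
    qed
    moreover have "y \<in> W \<rightarrow>\<^sub>E Q" "z \<in> W \<rightarrow>\<^sub>E Q" using y z by (simp_all add: sols_def)
    ultimately show "y = z" using eq by (intro PiE_ext[of y W _ z]) auto
  qed
  moreover have "card Q ^ (card W - 1) \<le> card (sols W Q R)"
  proof (cases "card W \<le> 1")
    case True
    have "(\<lambda>_\<in>W. q) \<in> sols W Q R" using q by (auto simp: sols_def R_def)
    moreover have "finite (sols W Q R)"
      by (rule finite_sols[OF W(1) Q(1)])
    ultimately have "card (sols W Q R) > 0" by (auto simp: card_gt_0_iff)
    then show ?thesis using True by simp
  next
    case False
    then have "W \<noteq> {}" by auto
    then obtain i where i: "i \<in> W" by blast
    have fin: "finite (sols W Q R)"
      by (rule finite_sols[OF W(1) Q(1)])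
    have "inj_on (\<lambda>x. \<lambda>_\<in>W. x) Q"
      using i by (intro inj_onI) (metis restrict_apply')
    moreover have "(\<lambda>x. \<lambda>_\<in>W. x) ` Q \<subseteq> sols W Q R"
      using False by (auto simp: sols_def R_def)
    ultimately have "card Q \<le> card (sols W Q R)" using fin by (metis card_inj_on_le)
    moreover have "card W - 1 = 1" using False W by simp
    ultimately show ?thesis by simp
  qed
  ultimately show ?thesis by blast
qed

section \<open>Window families\<close>

text \<open>The windows through a part form a cyclic arc of length \<open>s\<close>, and two parts
  share a window iff their arcs meet. The clique bound is thus Katona's bound on intersecting arcs,
  for which \<open>k \<ge> 2 * s\<close> is assumed.\<close>

lemma window_family_cyclic:
  assumes s: "s \<ge> 1" and k: "k \<ge> 2 * s"
  shows "window_family s k s k (\<lambda>l. (\<lambda>r. (l + r) mod k) ` {..<s})"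
    and "\<And>l. card ((\<lambda>r. (l + r) mod k) ` {..<s}) = s"
proof -
  let ?W = "\<lambda>l. (\<lambda>r. (l + r) mod k) ` {..<s}"
  have k0: "k > 0" using s k by simp
  show "card (?W l) = s" for l
  proof -
    have "inj_on (\<lambda>r. (l + r) mod k) {..<s}"
    proof (rule inj_onI)
      fix a b assume ab: "a \<in> {..<s}" "b \<in> {..<s}" and "(l + a) mod k = (l + b) mod k"
      then have "[l + a = l + b] (mod k)" by (simp add: cong_def)
      then have "[a = b] (mod k)" by (simp add: cong_add_lcancel_nat)
      then show "a = b" using ab k by (auto simp: cong_def)
    qed
    then show ?thesis by (simp add: card_image)
  qed
  show "window_family s k s k ?W"
    unfolding window_family_def
  proof (intro conjI allI impI)
    show "?W l \<subseteq> {..<k}" for l using k0 by auto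
    show "card {l. l < k \<and> i \<in> ?W l} \<le> s" if i: "i < k" for i
    proof -
      \<comment> \<open>The window index is \<open>i - r\<close> modulo \<open>k\<close>, written
        with \<open>k - r\<close> to avoid truncated subtraction.\<close>
      have "{l. l < k \<and> i \<in> ?W l} \<subseteq> (\<lambda>r. (i + (k - r)) mod k) ` {..<s}"
      proof
        fix l assume "l \<in> {l. l < k \<and> i \<in> ?W l}"
        then obtain r where r: "l < k" "r < s" "i = (l + r) mod k" by auto
        have "(i + (k - r)) mod k = (l + r + (k - r)) mod k"
          unfolding r(3) by (rule mod_add_left_eq)
        also have "l + r + (k - r) = l + k" using r s k by simp
        also have "(l + k) mod k = l" using r by simp
        finally show "l \<in> (\<lambda>r. (i + (k - r)) mod k) ` {..<s}" using r by force
      qed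
      then have "card {l. l < k \<and> i \<in> ?W l} \<le> card {..<s}"
        by (meson card_image_le card_mono finite_imageI finite_lessThan le_trans)
      then show ?thesis by simp
    qed
    fix S assume S: "S \<subseteq> {..<k}"
      and common: "\<forall>i\<in>S. \<forall>j\<in>S. i \<noteq> j \<longrightarrow> (\<exists>l<k. i \<in> ?W l \<and> j \<in> ?W l)"
    show "card S \<le> s"
    proof (cases "S = {}")
      case False
      then obtain a where a: "a \<in> S" by blast
      \<comment> \<open>The cyclic distance from \<open>y\<close> forward to \<open>x\<close>. Parts
        in a common window are at distance less than \<open>s\<close> in one of the two
        directions.\<close>
      define D where "D x y = (int x - int y) mod int k" for x y
      have close: "D x y < int s \<or> D y x < int s" if xy: "x \<in> S" "y \<in> S" for x y
      proof (cases "x = y")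
        case True
        then show ?thesis using s by (simp add: D_def)
      next
        case False
        then obtain l where "x \<in> ?W l" "y \<in> ?W l"
          using common[rule_format, OF xy False] by (elim exE conjE)
        then obtain r r' where r: "r < s" "r' < s" "x = (l + r) mod k" "y = (l + r') mod k"
          by auto
        have *: "D x y = (int r - int r') mod int k" "D y x = (int r' - int r) mod int k"
          unfolding D_def r(3,4) of_nat_mod by (simp_all add: mod_simps)
        show ?thesis
        proof (cases "r \<ge> r'")
          case True
          then have "D x y = int r - int r'" using * r k by (simp add: mod_pos_pos_trivial)
          then show ?thesis using r by simp
        next
          case False
          then have "D y x = int r' - int r" using * r k by (simp add: mod_pos_pos_trivial)
          then show ?thesis using r by simp
        qed
      qed
      have D_range: "0 \<le> D x y" "D x y < int k" for x y using k0 by (simp_all add: D_def)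
      have D_swap: "D y x = int k - D x y" if "D x y \<noteq> 0" for x y
      proof -
        have "D y x = (- (int x - int y)) mod int k" by (simp add: D_def)
        then show ?thesis using that zmod_zminus1_eq_if[of "int x - int y" "int k"]
          by (simp add: D_def split: if_splits)
      qed
      \<comment> \<open>As in Katona's cycle argument, the residues \<open>r\<close> and \<open>r - s\<close> around \<open>a\<close>, for \<open>0 < r < s\<close>, lie
        in no common window, so at most one of each such pair is in \<open>S\<close>.\<close>
      define \<phi> where "\<phi> x = (if D x a < int s then D x a else D x a - (int k - int s))" for x
      have "\<phi> x \<in> {0..<int s}" if x: "x \<in> S" for x
      proof (cases "D x a < int s")
        case True
        then show ?thesis using D_range by (simp add: \<phi>_def)
      next
        case False
        then have "D a x < int s" "D a x = int k - D x a" using close[OF x a] D_swap[of x a] s by auto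
        then show ?thesis using False D_range[of x a] by (simp add: \<phi>_def)
      qed
      moreover have "inj_on \<phi> S"
      proof (rule inj_onI)
        fix x y assume x: "x \<in> S" and y: "y \<in> S" and eq: "\<phi> x = \<phi> y"
        have D_diff: "D x y = (D x a - D y a) mod int k" for x y
          by (simp add: D_def mod_simps)
        \<comment> \<open>Equal values of \<open>\<phi>\<close> from different branches put the two
          parts at distance \<open>k - s\<close> one way and \<open>s\<close> the other. Both are at
          least \<open>s\<close> as \<open>k \<ge> 2 * s\<close>, contradicting
          \<open>close\<close>.\<close>
        have far: False
          if "x \<in> S" "y \<in> S" "D x a - D y a = int k - int s" for x y
        proof -
          have "D x y = (int k - int s) mod int k" using D_diff[of x y] that(3) by (simp only:)
          also have "\<dots> = int k - int s" by (rule mod_pos_pos_trivial) (use s k in auto)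
          finally have "D x y = int k - int s" .
          moreover from this have "D y x = int s" using D_swap[of x y] k s by simp
          ultimately show False using close[OF that(1,2)] k by simp
        qed
        have "D x a = D y a"
          using eq far[OF x y] far[OF y x] unfolding \<phi>_def by (auto split: if_splits)
        then have "D x y = 0" using D_diff[of x y] by simp
        then have "int x mod int k = int y mod int k"
          by (simp add: D_def mod_eq_dvd_iff mod_0_imp_dvd)
        moreover have "x < k" "y < k" using S x y by auto
        ultimately show "x = y" by (simp flip: of_nat_mod)
      qed
      ultimately have "card S \<le> card {0..<int s}"
        by (intro card_inj_on_le[of \<phi>]) auto
      then show ?thesis by simp
    qed simp
  qed
qed

lemma window_family_single:
  assumes "k \<le> s"
  shows "window_family s k 1 1 (\<lambda>_. {..<k})"
proof -
  have "card S \<le> s" if "S \<subseteq> {..<k}" for S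
    using card_mono[OF _ that] assms by simp
  moreover have "card {l. l < Suc 0 \<and> i < k} \<le> 1" for i
    by (rule order.trans[OF card_mono[of "{0}"]]) auto
  ultimately show ?thesis by (simp add: window_family_def)
qed

lemma window_family_two:
  assumes "s \<le> k" "k < 2 * s"
  shows "window_family s k 1 2 (\<lambda>l. if l = 0 then {..<s} else {s..<k})"
  unfolding window_family_def
proof (intro conjI allI impI)
  let ?W = "\<lambda>l::nat. if l = 0 then {..<s} else {s..<k}"
  show "?W l \<subseteq> {..<k}" for l using assms by auto
  show "card {l. l < 2 \<and> i \<in> ?W l} \<le> 1" for i
    by (rule order.trans[OF card_mono[of "{if i < s then 0 else 1}"]])
      (auto simp: less_2_cases_iff split: if_splits)
  fix S assume S: "S \<subseteq> {..<k}"
    "\<forall>i\<in>S. \<forall>j\<in>S. i \<noteq> j \<longrightarrow> (\<exists>l<2. i \<in> ?W l \<and> j \<in> ?W l)"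
  show "card S \<le> s"
  proof (cases "\<exists>i\<in>S. i < s")
    case True
    then obtain i where i: "i \<in> S" "i < s" by blast
    have "j < s" if j: "j \<in> S" for j
    proof (cases "i = j")
      case False
      then obtain l where "i \<in> ?W l" "j \<in> ?W l" using S(2) i(1) j by blast
      then show ?thesis using i(2) by (auto split: if_splits)
    qed (use i in simp)
    then have "S \<subseteq> {..<s}" by auto
    then show ?thesis using card_mono[of "{..<s}" S] by simp
  next
    case False
    then have "S \<subseteq> {s..<k}" using S(1) by (auto simp: not_less)
    then show ?thesis using card_mono[of "{s..<k}" S] assms by simp
  qed
qed

section \<open>Asymptotics\<close>

lemma prod_card_sols_le_m:
  assumes "window_family s k D L W" "s \<ge> 2" "k \<ge> 1" "finite Q" "Q \<noteq> {}"
    and "\<And>l. l < L \<Longrightarrow> rigid (W l) Q (R l)" and "k * card Q ^ D \<le> n"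
  shows "(\<Prod>l<L. card (sols (W l) Q (R l))) \<le> m (Suc s) n k"
  by (rule window_graph.prod_card_sols_le_m) (use assms in \<open>unfold_locales; simp\<close>)

text \<open>With no windows there is one vertex per part plus padding, and the empty product gives
  one \<open>k\<close>-MIS. This covers the \<open>n\<close> that the asymptotic bounds do not
  reach.\<close>

lemma m_pos:
  assumes "s \<ge> 2" "k \<ge> 1" "n \<ge> k"
  shows "m (Suc s) n k \<ge> 1"
proof -
  have "card S \<le> s" if "\<forall>i\<in>S. \<forall>j\<in>S. i = j" for S :: "nat set"
  proof -
    have "card S \<le> 1" using that by (cases "finite S") (simp_all add: card_le_Suc0_iff_eq)
    then show ?thesis using assms(1) by simp
  qed
  then have "window_family s k 0 0 (\<lambda>_. {})" by (simp add: window_family_def)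
  from prod_card_sols_le_m[OF this assms(1,2), of "{()}" "\<lambda>_ _ _ _ _. True" n]
  show ?thesis using assms(3) by simp
qed

text \<open>\<open>M\<close> is the integer part of the \<open>p\<close>-th root of
  \<open>n / a\<close>. Rounding down costs at most a factor \<open>2\<close> once the root is at
  least \<open>1\<close>.\<close>

lemma eventually_root_scale:
  fixes a p :: nat
  assumes "a \<ge> 1" "p \<ge> 1"
  obtains c :: real where "c > 0"
    "eventually (\<lambda>n. \<exists>M\<ge>1. a * M ^ p \<le> n \<and> c * real n powr (1 / real p) \<le> real M) sequentially"
proof
  define r where "r n = (real n / real a) powr (1 / real p)" for n :: nat
  show "(1 / real a) powr (1 / real p) / 2 > 0" using assms by simp
  have "\<exists>M\<ge>1. a * M ^ p \<le> n \<and> (1 / real a) powr (1 / real p) / 2 * real n powr (1 / real p) \<le> real M"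
    if n: "n \<ge> a" for n
  proof (intro exI conjI)
    have "1 \<le> real n / real a" using n assms by simp
    then have r: "1 \<le> r n" unfolding r_def by (intro ge_one_powr_ge_zero) auto
    let ?M = "nat \<lfloor>r n\<rfloor>"
    have M: "real ?M \<le> r n" "r n \<le> real ?M + 1" using r by linarith+
    show M1: "1 \<le> ?M" using r by linarith
    have "real ?M ^ p \<le> r n ^ p" using M by (intro power_mono) auto
    also have "\<dots> = real n / real a"
      using assms n r unfolding r_def by (simp add: powr_realpow[symmetric] powr_powr)
    finally have "real a * real ?M ^ p \<le> real n" using assms by (simp add: field_simps)
    then show "a * ?M ^ p \<le> n" by (simp flip: of_nat_power of_nat_mult)
    have "r n = (1 / real a) powr (1 / real p) * real n powr (1 / real p)"
      unfolding r_def by (simp flip: powr_mult)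
    then show "(1 / real a) powr (1 / real p) / 2 * real n powr (1 / real p) \<le> real ?M"
      using M M1 by linarith
  qed
  then show "eventually (\<lambda>n. \<exists>M\<ge>1. a * M ^ p \<le> n \<and>
      (1 / real a) powr (1 / real p) / 2 * real n powr (1 / real p) \<le> real M) sequentially"
    by (rule eventually_sequentiallyI)
qed

text \<open>With \<open>q\<close> labels the graph needs at most \<open>k * q ^ D\<close> vertices,
  so \<open>q\<close> can be of order \<open>n powr (1 / D)\<close>. A window of size
  \<open>w\<close> contributes \<open>q ^ (w - 1)\<close>, hence \<open>q ^ e\<close> in
  total.\<close>

lemma m3_bigomega:
  assumes F: "window_family 2 k D L W" and k: "k \<ge> 1" and D: "D \<ge> 1"
    and e: "(\<Sum>l<L. card (W l) - 1) = e"
  shows "(\<lambda>n. real (m 3 n k)) \<in> \<Omega>(\<lambda>n. real n powr (real e / real D))"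
proof -
  obtain c :: real where c: "c > 0" and ev:
    "eventually (\<lambda>n. \<exists>M\<ge>1. k * M ^ D \<le> n \<and> c * real n powr (1 / real D) \<le> real M) sequentially"
    using eventually_root_scale[OF k D] .
  have fin: "finite (W l)" if "l < L" for l
    using window_family_subset[OF F that] finite_subset by blast
  have "eventually (\<lambda>n. c ^ e * norm (real n powr (real e / real D)) \<le> norm (real (m 3 n k))) sequentially"
    using ev
  proof eventually_elim
    case (elim n)
    then obtain q where q: "q \<ge> 1" "k * q ^ D \<le> n" "c * real n powr (1 / real D) \<le> real q" by blast
    have "\<exists>R. rigid (W l) {..<q} R \<and> q ^ (card (W l) - 1) \<le> card (sols (W l) {..<q} R)"
      if "l < L" for l
      using rigid_diagonal[OF fin[OF that] window_family_card_le[OF F that], of "{..<q}"] q(1)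
      by (simp add: lessThan_empty_iff)
    then obtain R where R: "\<And>l. l < L \<Longrightarrow> rigid (W l) {..<q} (R l)"
      "\<And>l. l < L \<Longrightarrow> q ^ (card (W l) - 1) \<le> card (sols (W l) {..<q} (R l))"
      by metis
    have "q ^ e = (\<Prod>l<L. q ^ (card (W l) - 1))" by (simp add: e[symmetric] power_sum)
    also have "\<dots> \<le> (\<Prod>l<L. card (sols (W l) {..<q} (R l)))"
      using R(2) by (intro prod_mono) simp
    also have "\<dots> \<le> m (Suc 2) n k"
      by (rule prod_card_sols_le_m[OF F _ k]) (use R(1) q in \<open>auto simp: lessThan_empty_iff\<close>)
    finally have "q ^ e \<le> m 3 n k" by (simp add: eval_nat_numeral)
    then have "real q ^ e \<le> real (m 3 n k)" by (simp flip: of_nat_power)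
    moreover have "(c * real n powr (1 / real D)) ^ e \<le> real q ^ e"
      using q(3) c by (intro power_mono) auto
    moreover have "(real n powr (1 / real D)) ^ e = real n powr (real e / real D)"
    proof (cases "n = 0")
      case True
      then show ?thesis using q k by simp
    next
      case False
      then show ?thesis by (simp add: powr_realpow[symmetric] powr_powr)
    qed
    ultimately have "c ^ e * real n powr (real e / real D) \<le> real (m 3 n k)"
      by (simp only: power_mult_distrib)
    then show ?case by simp
  qed
  then show ?thesis using c by (intro landau_omega.bigI[of "c ^ e"]) auto
qed

text \<open>Here \<open>n\<close> is of order \<open>M ^ (d * D)\<close>, the main term is
  \<open>M ^ (d * e)\<close>, and the Gram matrices cost a constant times \<open>M ^ K\<close> with
  \<open>K\<close> independent of \<open>d\<close>. In terms of \<open>n\<close> this loss has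
  exponent \<open>K / (d * D)\<close>, which a large \<open>d\<close> makes small.\<close>

lemma m_eventually_ge:
  assumes F: "window_family s k D L W" and s: "s \<ge> 2" and k: "k \<ge> 1" and D: "D \<ge> 1"
    and e: "(\<Sum>l<L. card (W l) - 1) = e" and \<delta>: "\<delta> > 0"
  shows "eventually (\<lambda>n. real n powr (real e / real D - \<delta>) \<le> real (m (Suc s) n k)) sequentially"
proof -
  define K where "K = 2 * s\<^sup>2 * L"
  \<comment> \<open>Half of \<open>\<delta>\<close> pays for the Gram matrices, the other half for
    the constants at the end.\<close>
  obtain d :: nat where d: "d \<ge> 1" "real K / real d \<le> \<delta> / 2"
  proof
    show "nat \<lceil>2 * real K / \<delta>\<rceil> + 1 \<ge> 1" by simp
    have "2 * real K / \<delta> \<le> real (nat \<lceil>2 * real K / \<delta>\<rceil> + 1)" by linarith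
    then have "2 * real K \<le> real (nat \<lceil>2 * real K / \<delta>\<rceil> + 1) * \<delta>"
      using \<delta> by (simp only: pos_divide_le_eq)
    then show "real K / real (nat \<lceil>2 * real K / \<delta>\<rceil> + 1) \<le> \<delta> / 2"
      by (simp add: field_simps)
  qed
  define p where "p = d * D"
  have p: "p \<ge> 1" using d D by (simp add: p_def)
  have Kp: "real K / real p \<le> \<delta> / 2"
  proof -
    have "d \<le> p" using D by (simp add: p_def)
    then have "real K / real p \<le> real K / real d" using d by (intro divide_left_mono) auto
    then show ?thesis using d(2) by linarith
  qed
  \<comment> \<open>The box has \<open>(2 * s * M + 1) ^ d\<close> points, at most
    \<open>(3 * s * M) ^ d\<close>, so \<open>a * M ^ p\<close> bounds
    \<open>k * card Q ^ D\<close>.\<close>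
  define a where "a = k * (3 * s) ^ p"
  have a: "a \<ge> 1" using k s by (simp add: a_def)
  define A where "A = ((3 * d * s\<^sup>2) ^ s\<^sup>2) ^ L"
  have A: "A \<ge> 1" using d s by (simp add: A_def)
  obtain c :: real where c: "c > 0" and ev:
    "eventually (\<lambda>n. \<exists>M\<ge>1. a * M ^ p \<le> n \<and> c * real n powr (1 / real p) \<le> real M) sequentially"
    using eventually_root_scale[OF a p] .
  have fin: "finite (W l)" if "l < L" for l
    using window_family_subset[OF F that] finite_subset by blast
  have "eventually (\<lambda>n. c ^ (d * e) / real A * real n powr (real e / real D - \<delta> / 2)
      \<le> real (m (Suc s) n k)) sequentially"
    using ev eventually_ge_at_top[of 1]
  proof eventually_elim
    case (elim n)
    then obtain M where M: "M \<ge> 1" "a * M ^ p \<le> n" "c * real n powr (1 / real p) \<le> real M" by blast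
    define Q where "Q = {..<d} \<rightarrow>\<^sub>E {- int (s * M)..int (s * M)}"
    have "\<exists>R. rigid (W l) Q R \<and>
      M ^ (d * (card (W l) - 1)) \<le> card (sols (W l) Q R) * ((3 * d * s\<^sup>2) ^ s\<^sup>2 * M ^ (2 * s\<^sup>2))"
      if l: "l < L" for l
    proof -
      obtain R where R: "rigid (W l) Q R" "M ^ (d * (card (W l) - 1)) \<le>
          card (sols (W l) Q R) * (2 * (d * (s * M)\<^sup>2) + 1) ^ (card (W l) * card (W l))"
        using rigid_zero_sum[OF fin[OF l] window_family_card_le[OF F l] M(1), of d]
        unfolding Q_def by blast
      have "1 \<le> d * (s * M)\<^sup>2" using d s M by simp
      then have "(2 * (d * (s * M)\<^sup>2) + 1) ^ (card (W l) * card (W l))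
          \<le> (3 * (d * (s * M)\<^sup>2)) ^ (card (W l) * card (W l))"
        by (intro power_mono) auto
      also have "\<dots> \<le> (3 * (d * (s * M)\<^sup>2)) ^ s\<^sup>2"
        using window_family_card_le[OF F l] \<open>1 \<le> d * (s * M)\<^sup>2\<close>
        by (intro power_increasing) (auto simp: power2_eq_square intro: mult_le_mono)
      also have "\<dots> = (3 * d * s\<^sup>2) ^ s\<^sup>2 * M ^ (2 * s\<^sup>2)"
        by (simp add: power_mult_distrib power_mult mult.assoc)
      finally show ?thesis using R by (meson le_trans mult_le_mono2)
    qed
    then obtain R where R: "\<And>l. l < L \<Longrightarrow> rigid (W l) Q (R l)"
      "\<And>l. l < L \<Longrightarrow> M ^ (d * (card (W l) - 1)) \<le>
        card (sols (W l) Q (R l)) * ((3 * d * s\<^sup>2) ^ s\<^sup>2 * M ^ (2 * s\<^sup>2))"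
      by metis
    have Q: "finite Q" "card Q = (2 * (s * M) + 1) ^ d"
      by (simp_all add: Q_def finite_PiE card_PiE nat_add_distrib nat_mult_distrib mult.commute)
    then have "Q \<noteq> {}" by fastforce
    have "card Q ^ D = (2 * (s * M) + 1) ^ p" by (simp add: Q p_def power_mult)
    also have "\<dots> \<le> (3 * s * M) ^ p" using s M by (intro power_mono) auto
    finally have "k * card Q ^ D \<le> k * (3 * s * M) ^ p" by simp
    also have "\<dots> = a * M ^ p" by (simp add: a_def power_mult_distrib)
    finally have kQ: "k * card Q ^ D \<le> n" using M(2) by simp
    have "M ^ (d * e) = (\<Prod>l<L. M ^ (d * (card (W l) - 1)))"
      by (simp add: e[symmetric] power_sum sum_distrib_left)
    also have "\<dots> \<le> (\<Prod>l<L. card (sols (W l) Q (R l)) * ((3 * d * s\<^sup>2) ^ s\<^sup>2 * M ^ (2 * s\<^sup>2)))"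
      using R(2) by (intro prod_mono) simp
    also have "\<dots> = (\<Prod>l<L. card (sols (W l) Q (R l))) * (A * M ^ K)"
      by (simp add: prod.distrib A_def K_def power_mult_distrib power_mult)
    also have "\<dots> \<le> m (Suc s) n k * (A * M ^ K)"
      using prod_card_sols_le_m[OF F s k Q(1) \<open>Q \<noteq> {}\<close> R(1) kQ] by simp
    finally have "real (M ^ (d * e)) \<le> real (m (Suc s) n k * (A * M ^ K))"
      by (simp only: of_nat_le_iff)
    then have le: "real M ^ (d * e) \<le> real (m (Suc s) n k) * real A * real M ^ K" by simp
    have n: "real n > 0" using elim by simp
    have "M ^ p \<le> a * M ^ p" using a by simp
    then have "real (M ^ p) \<le> real n" using M(2) by (simp only: of_nat_le_iff)
    then have Mp: "real M powr real p \<le> real n" using M by (simp add: powr_realpow)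
    have "real M ^ K = real M powr real K" using M by (simp add: powr_realpow)
    also have "\<dots> = (real M powr real p) powr (real K / real p)" using p by (simp add: powr_powr)
    also have "\<dots> \<le> real n powr (real K / real p)" using Mp by (intro powr_mono2) auto
    also have "\<dots> \<le> real n powr (\<delta> / 2)" using Kp elim by (intro powr_mono) auto
    finally have MK: "real M ^ K \<le> real n powr (\<delta> / 2)" .
    have "c ^ (d * e) * real n powr (real e / real D) = (c * real n powr (1 / real p)) ^ (d * e)"
      using n d D by (simp add: power_mult_distrib powr_realpow[symmetric] powr_powr p_def)
    also have "\<dots> \<le> real M ^ (d * e)" using M c by (intro power_mono) auto
    also have "\<dots> \<le> real (m (Suc s) n k) * real A * real n powr (\<delta> / 2)"
      by (rule order.trans[OF le]) (intro mult_left_mono MK, simp)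
    finally have "c ^ (d * e) * real n powr (real e / real D)
      \<le> real (m (Suc s) n k) * real A * real n powr (\<delta> / 2)" .
    then have "c ^ (d * e) * (real n powr (real e / real D) / real n powr (\<delta> / 2))
      \<le> real (m (Suc s) n k) * real A"
      using n by (simp add: pos_divide_le_eq)
    then have "c ^ (d * e) * real n powr (real e / real D - \<delta> / 2) \<le> real (m (Suc s) n k) * real A"
      by (simp only: powr_diff)
    then show ?case using A by (simp only: times_divide_eq_left) (simp only: pos_divide_le_eq of_nat_0_less_iff)
  qed
  \<comment> \<open>The remaining factor \<open>n powr (\<delta> / 2)\<close> eventually exceeds the
    constant \<open>real A / c ^ (d * e)\<close>.\<close>
  moreover have "eventually (\<lambda>n. real n powr (real e / real D - \<delta>)
      \<le> c ^ (d * e) / real A * real n powr (real e / real D - \<delta> / 2)) sequentially"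
  proof -
    have C: "c ^ (d * e) / real A > 0" using c A by simp
    show ?thesis using C \<delta> by real_asymp
  qed
  ultimately show ?thesis by eventually_elim linarith
qed

text \<open>The deficit of \<open>log n (f n)\<close> below \<open>x\<close>, cut off at
  \<open>0\<close>, serves as the error term. It eventually drops below every positive bound, and
  \<open>f n \<ge> 1\<close> keeps the logarithm meaningful for every \<open>n \<ge> k\<close>
  except \<open>n = 1\<close>, where the power is \<open>1\<close>.\<close>

lemma exists_smallo_exponent:
  fixes f :: "nat \<Rightarrow> nat"
  assumes k: "k \<ge> 1" and pos: "\<And>n. n \<ge> k \<Longrightarrow> f n \<ge> 1"
    and ev: "\<And>\<delta>. \<delta> > 0 \<Longrightarrow> eventually (\<lambda>n. real n powr (x - \<delta>) \<le> real (f n)) sequentially"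
  shows "\<exists>\<epsilon> :: nat \<Rightarrow> real. \<epsilon> \<in> o(\<lambda>_. 1) \<and> (\<forall>n\<ge>k. real (f n) \<ge> real n powr (x - \<epsilon> n))"
proof (intro exI conjI allI impI)
  define \<epsilon> where "\<epsilon> n = max 0 (x - log (real n) (real (f n)))" for n
  show "real n powr (x - \<epsilon> n) \<le> real (f n)" if n: "n \<ge> k" for n
  proof (cases "n = 1")
    case True
    then show ?thesis using pos[OF n] by simp
  next
    case False
    then have n2: "real n > 1" using n k by simp
    have "real n powr (x - \<epsilon> n) \<le> real n powr log (real n) (real (f n))"
      using n2 by (intro powr_mono) (auto simp: \<epsilon>_def)
    also have "\<dots> = real (f n)" using n2 pos[OF n] by simp
    finally show ?thesis .
  qed
  have "\<epsilon> \<longlonglongrightarrow> 0"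
  proof (rule LIMSEQ_I)
    fix r :: real assume "r > 0"
    then have "eventually (\<lambda>n. real n powr (x - r / 2) \<le> real (f n)) sequentially"
      by (intro ev) simp
    then have "eventually (\<lambda>n. norm (\<epsilon> n - 0) < r) sequentially"
      using eventually_ge_at_top[of "max 2 k"]
    proof eventually_elim
      case (elim n)
      then have n2: "real n > 1" and "real (f n) > 0" using pos[of n] by auto
      then have "x - r / 2 \<le> log (real n) (real (f n))"
        using elim(1) by (simp add: le_log_iff)
      then show ?case using \<open>r > 0\<close> by (simp add: \<epsilon>_def max_def)
    qed
    then show "\<exists>no. \<forall>n\<ge>no. norm (\<epsilon> n - 0) < r" by (simp add: eventually_sequentially)
  qed
  then show "\<epsilon> \<in> o(\<lambda>_. 1)" by (intro smalloI_tendsto) auto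
qed


text \<open>Disjoint windows covering all parts give as exponent \<open>k\<close> minus their
  number. One window is used when \<open>k / s \<le> 1\<close> and two when
  \<open>1 < k / s < 2\<close>, so their number is \<open>k / s\<close> rounded up.\<close>

lemma window_family_below:
  assumes s: "s \<ge> 2" and k: "k \<ge> 1" "k < 2 * s"
  obtains L W e where "window_family s k 1 L W" "(\<Sum>l<L. card (W l) - 1) = e"
    "\<lfloor>real (s - 1) * real k / real s\<rfloor> = int e"
proof -
  have eq: "real (s - 1) * real k / real s = real k - real k / real s"
    using s by (simp add: of_nat_diff field_simps)
  show thesis
  proof (cases "k \<le> s")
    case True
    then have "0 < real k / real s" "real k / real s \<le> 1" using s k by auto
    then have "\<lfloor>real (s - 1) * real k / real s\<rfloor> = int (k - 1)"
      unfolding eq using k by (simp add: floor_eq_iff of_nat_diff)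
    then show thesis using that[OF window_family_single[OF True]] by simp
  next
    case False
    then have "1 < real k / real s" "real k / real s < 2" using s k by (auto simp: field_simps)
    then have "\<lfloor>real (s - 1) * real k / real s\<rfloor> = int (k - 2)"
      unfolding eq using False s by (simp add: floor_eq_iff of_nat_diff)
    moreover have "(\<Sum>l<(2::nat). card (if l = 0 then {..<s} else {s..<k}) - 1) = k - 2"
      using False s by (simp add: numeral_2_eq_2)
    ultimately show thesis using that[OF window_family_two] False k by simp
  qed
qed

theorem theorem1p4:
  fixes k t :: nat
  assumes "k \<ge> 1" and "t \<ge> 3"
  shows
    "(t = 3 \<and> k < 4 \<longrightarrow>
        (\<lambda>n. real (m 3 n k)) \<in> \<Omega>(\<lambda>n. real n powr real_of_int \<lfloor>real k / 2\<rfloor>)) \<and>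
     (t \<ge> 4 \<and> k < 2 * (t - 1) \<longrightarrow>
        (\<exists>\<epsilon> :: nat \<Rightarrow> real. \<epsilon> \<in> o(\<lambda>_. 1) \<and>
          (\<forall>n\<ge>k. real (m t n k) \<ge>
             real n powr (real_of_int \<lfloor>(real t - 2) * real k / (real t - 1)\<rfloor> - \<epsilon> n)))) \<and>
     (t = 3 \<and> k \<ge> 4 \<longrightarrow>
        (\<lambda>n. real (m 3 n k)) \<in> \<Omega>(\<lambda>n. real n powr (real k / 2))) \<and>
     (t \<ge> 4 \<and> k \<ge> 2 * (t - 1) \<longrightarrow>
        (\<exists>\<epsilon> :: nat \<Rightarrow> real. \<epsilon> \<in> o(\<lambda>_. 1) \<and>
          (\<forall>n\<ge>k. real (m t n k) \<ge>
             real n powr ((real t - 2) * real k / (real t - 1) - \<epsilon> n))))"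
proof -
  \<comment> \<open>Cliques may meet at most \<open>s\<close> parts, so \<open>K_t\<close>-freeness
    corresponds to \<open>Suc s = t\<close>.\<close>
  define s where "s = t - 1"
  have s: "s \<ge> 2" "Suc s = t" using assms(2) by (simp_all add: s_def)
  have rs: "real t - 2 = real (s - 1)" "real t - 1 = real s"
    using s by (auto simp: of_nat_diff)
  note pos = m_pos[OF s(1) assms(1), unfolded s(2)]
  note cyc = window_family_cyclic[of s k]
  \<comment> \<open>Divided by \<open>D = s\<close>, this sum gives the exponent
    \<open>(t - 2) * k / (t - 1)\<close>.\<close>
  have cyc_sum: "(\<Sum>l<k. card ((\<lambda>r. (l + r) mod k) ` {..<s}) - 1) = k * (s - 1)"
    if "k \<ge> 2 * s"
    using cyc(2) that s by simp
  show ?thesis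
  proof (intro conjI impI; elim conjE)
    assume "t = 3" "k < 4"
    obtain L W e where W: "window_family 2 k 1 L W" "(\<Sum>l<L. card (W l) - 1) = e"
      "\<lfloor>real (2 - 1) * real k / real 2\<rfloor> = int e"
      using window_family_below[of 2 k] assms(1) \<open>k < 4\<close> by auto
    then show "(\<lambda>n. real (m 3 n k)) \<in> \<Omega>(\<lambda>n. real n powr real_of_int \<lfloor>real k / 2\<rfloor>)"
      using m3_bigomega[OF W(1) assms(1) _ W(2)] by simp
  next
    assume "t = 3" "k \<ge> 4"
    then have s2: "s = 2" using s by simp
    show "(\<lambda>n. real (m 3 n k)) \<in> \<Omega>(\<lambda>n. real n powr (real k / 2))"
      using m3_bigomega[OF cyc(1)[unfolded s2] assms(1) _ cyc_sum[unfolded s2]] \<open>k \<ge> 4\<close> by simp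
  next
    assume "t \<ge> 4" "k < 2 * (t - 1)"
    then have "k < 2 * s" by (simp add: s_def)
    then obtain L W e where W: "window_family s k 1 L W" "(\<Sum>l<L. card (W l) - 1) = e"
      "\<lfloor>real (s - 1) * real k / real s\<rfloor> = int e"
      using window_family_below[OF s(1) assms(1)] by blast
    show "\<exists>\<epsilon> :: nat \<Rightarrow> real. \<epsilon> \<in> o(\<lambda>_. 1) \<and> (\<forall>n\<ge>k. real (m t n k) \<ge>
        real n powr (real_of_int \<lfloor>(real t - 2) * real k / (real t - 1)\<rfloor> - \<epsilon> n))"
      unfolding rs W(3)
      by (rule exists_smallo_exponent[OF assms(1) pos])
        (use m_eventually_ge[OF W(1) s(1) assms(1) _ W(2)] s(2) in simp_all)
  next
    assume "t \<ge> 4" "k \<ge> 2 * (t - 1)"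
    then have ks: "k \<ge> 2 * s" by (simp add: s_def)
    show "\<exists>\<epsilon> :: nat \<Rightarrow> real. \<epsilon> \<in> o(\<lambda>_. 1) \<and> (\<forall>n\<ge>k. real (m t n k) \<ge>
        real n powr ((real t - 2) * real k / (real t - 1) - \<epsilon> n))"
    proof (rule exists_smallo_exponent[OF assms(1) pos])
      fix \<delta> :: real assume "\<delta> > 0"
      then show "eventually (\<lambda>n. real n powr ((real t - 2) * real k / (real t - 1) - \<delta>)
          \<le> real (m t n k)) sequentially"
        using m_eventually_ge[OF cyc(1) s(1) assms(1) _ cyc_sum[OF ks], of \<delta>] s ks
        unfolding rs by (simp add: mult.commute)
    qed
  qed
qed

end
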